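(* (Blatz–Ko–Ogden model, genuine nonlinearity.) Let $\lambda,\mu,\rho_0>0$, $\beta=\frac{\lambda}{2\mu}$, $f\in(0,1)$, and, writing $s=1+\Gamma>0$, let $$P=\frac{\mu s}{\rho_0}\Big\{f\big[1-s^{-2\beta-2}\big]+\frac{1-f}{s^4}\big[s^{2\beta+2}-1\big]\Big\}.$$ (i) If $\beta\in[\frac12,1]$, then $P''(s)<0$ for all $s>0$. (ii) If $\beta\in(0,\frac12)\cup(1,\infty)$, then $P''(s)<0$ for all $s\le s_0$, where $s_0=\Big[\frac{6}{(2\beta-1)(\beta-1)}\Big]^{\frac1{2\beta+2}}$. (iii) If $\beta\in(0,\frac12)\cup(1,\infty)$ and $s>s_0$, then there exists $s_2$ such that $P''(s)<0$ up to $s_2$ and then $P''$ changes its sign.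
   Context: Primes denote derivatives with respect to $s$ (equivalently $\Gamma=s-1$). The condition $P''<0$ is the genuine nonlinearity condition for the p-system $V_t-(P(\Gamma))_X=0$, $\Gamma_t-V_X=0$, $\Gamma>-1$. *)

theory Defs
  imports "HOL-Analysis.Analysis"
begin

(* Meaningful only for s > 0: powr takes the value 0 at base 0. *)
definition bko_P :: "real \<Rightarrow> real \<Rightarrow> real \<Rightarrow> real \<Rightarrow> real \<Rightarrow> real" where
  "bko_P \<mu> \<rho>\<^sub>0 \<beta> f s =
     \<mu> * s / \<rho>\<^sub>0 *
       (f * (1 - s powr (- 2 * \<beta> - 2)) + (1 - f) / s ^ 4 * (s powr (2 * \<beta> + 2) - 1))"

(* Used only for \<beta> \<in> (0,1/2) \<union> (1,\<infinity>), where (2\<beta> - 1)(\<beta> - 1) > 0. *)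
definition bko_s0 :: "real \<Rightarrow> real" where
  "bko_s0 \<beta> = (6 / ((2 * \<beta> - 1) * (\<beta> - 1))) powr (1 / (2 * \<beta> + 2))"

end

(* Dividing P'' by its dominant power s^(2 beta - 3) (and a positive constant) leaves a function, bko_h,
   whose remaining powers of s all have negative exponents and negative coefficients. So bko_h is strictly
   increasing and tends to (1 - f)(2 beta - 1)(beta - 1), which is positive in case (iii). At s_0 the two
   terms with factor 1 - f cancel, leaving a negative value. *)
theory Submission
  imports Defs
begin

definition bko_h :: "real \<Rightarrow> real \<Rightarrow> real \<Rightarrow> real" where
  "bko_h \<beta> f s = (1 - f) * ((2 * \<beta> - 1) * (\<beta> - 1)) - f * ((2 * \<beta> + 1) * (\<beta> + 1)) * s powr (- 4 * \<beta>)
     - 6 * (1 - f) * s powr (- 2 * \<beta> - 2)"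

text \<open>Multiplying out turns every quotient and product into a single power of
  \<open>s\<close>, so that both differentiations can be done term by term.\<close>

lemma bko_P_eq:
  assumes "s > 0"
  shows "bko_P \<mu> \<rho> \<beta> f s =
    \<mu> / \<rho> * (f * (s - s powr (- 2 * \<beta> - 1)) + (1 - f) * (s powr (2 * \<beta> - 1) - s powr (- 3)))"
proof -
  have p1: "s powr (- 2 * \<beta> - 1) = s * s powr (- 2 * \<beta> - 2)"
    using powr_mult_base[of s "- 2 * \<beta> - 2"] assms
    by (simp only: less_imp_le) (rule arg_cong[of _ _ "(powr) s"], simp)
  have p2: "s powr (2 * \<beta> - 1) = s powr (2 * \<beta> + 2) * s powr (- 3)"
    by (simp flip: powr_add)
  have p3: "s powr (- 3) = s * s powr (- 4)"
    using powr_mult_base[of s "- 4"] assms by simp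
  have p4: "(1 - f) / s ^ 4 = (1 - f) * s powr (- 4)"
    using assms by (simp add: powr_minus_divide)
  show ?thesis
    unfolding bko_P_def p1 p2 p3 p4 by (simp add: algebra_simps)
qed

text \<open>Two termwise differentiations, after which the power
  \<open>s powr (2 * \<beta> - 3)\<close> is factored out. For positive \<open>\<mu>\<close> and
  \<open>\<rho>\<close> the prefactor is positive, so \<open>bko_h\<close> alone carries the
  sign.\<close>

lemma deriv_deriv_bko_P:
  assumes "s > 0"
  shows "deriv (deriv (bko_P \<mu> \<rho> \<beta> f)) s = 2 * \<mu> / \<rho> * s powr (2 * \<beta> - 3) * bko_h \<beta> f s"
proof -
  define D where "D x = \<mu> / \<rho> * (f * (1 + (2 * \<beta> + 1) * x powr (- 2 * \<beta> - 2))
    + (1 - f) * ((2 * \<beta> - 1) * x powr (2 * \<beta> - 2) + 3 * x powr (- 4)))" for x :: real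
  have D1: "(bko_P \<mu> \<rho> \<beta> f has_field_derivative D x) (at x)" if "x > 0" for x
  \<comment> \<open>The expanded form is available for positive arguments only. As
    \<open>{0<..}\<close> is open, agreement there is enough for the derivatives to
    coincide.\<close>
  proof (rule has_field_derivative_transform_within_open[where S = "{0<..}"])
    show "((\<lambda>s. \<mu> / \<rho> * (f * (s - s powr (- 2 * \<beta> - 1))
        + (1 - f) * (s powr (2 * \<beta> - 1) - s powr (- 3)))) has_field_derivative D x) (at x)"
      unfolding D_def by (rule DERIV_cmult) (use that in \<open>auto intro!: derivative_eq_intros simp: algebra_simps\<close>)
  qed (use that in \<open>auto simp: bko_P_eq\<close>)
  have D2: "(D has_field_derivative 2 * \<mu> / \<rho> * (- f * ((2 * \<beta> + 1) * (\<beta> + 1)) * s powr (- 2 * \<beta> - 3)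
      + (1 - f) * ((2 * \<beta> - 1) * (\<beta> - 1) * s powr (2 * \<beta> - 3) - 6 * s powr (- 5)))) (at s)"
  proof -
    \<comment> \<open>The new coefficients are
      \<open>(2 * \<beta> + 1) * (- 2 * \<beta> - 2)\<close>,
      \<open>(2 * \<beta> - 1) * (2 * \<beta> - 2)\<close> and \<open>3 * (- 4)\<close>; each
      contains a factor 2, which is pulled out in front.\<close>
    have "((\<lambda>x. f * (1 + (2 * \<beta> + 1) * x powr (- 2 * \<beta> - 2))
        + (1 - f) * ((2 * \<beta> - 1) * x powr (2 * \<beta> - 2) + 3 * x powr (- 4))) has_field_derivative
        2 * (- f * ((2 * \<beta> + 1) * (\<beta> + 1)) * s powr (- 2 * \<beta> - 3)
      + (1 - f) * ((2 * \<beta> - 1) * (\<beta> - 1) * s powr (2 * \<beta> - 3) - 6 * s powr (- 5)))) (at s)"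
      using assms by (auto intro!: derivative_eq_intros simp: algebra_simps)
    from DERIV_cmult[OF this, of "\<mu> / \<rho>"] show ?thesis
      unfolding D_def by (simp add: mult.assoc mult.left_commute)
  qed
  have "(deriv (bko_P \<mu> \<rho> \<beta> f) has_field_derivative 2 * \<mu> / \<rho> *
      (- f * ((2 * \<beta> + 1) * (\<beta> + 1)) * s powr (- 2 * \<beta> - 3)
      + (1 - f) * ((2 * \<beta> - 1) * (\<beta> - 1) * s powr (2 * \<beta> - 3) - 6 * s powr (- 5)))) (at s)"
    by (rule has_field_derivative_transform_within_open[where S = "{0<..}", OF D2])
      (use assms DERIV_imp_deriv[OF D1] in auto)
  then have "deriv (deriv (bko_P \<mu> \<rho> \<beta> f)) s = 2 * \<mu> / \<rho> *
      (- f * ((2 * \<beta> + 1) * (\<beta> + 1)) * s powr (- 2 * \<beta> - 3)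
      + (1 - f) * ((2 * \<beta> - 1) * (\<beta> - 1) * s powr (2 * \<beta> - 3) - 6 * s powr (- 5)))"
    by (rule DERIV_imp_deriv)
  moreover have "s powr (- 2 * \<beta> - 3) = s powr (2 * \<beta> - 3) * s powr (- 4 * \<beta>)"
    "s powr (- 5) = s powr (2 * \<beta> - 3) * s powr (- 2 * \<beta> - 2)"
    by (simp_all flip: powr_add)
  ultimately show ?thesis
    unfolding bko_h_def by (simp only:) (simp add: algebra_simps)
qed

lemma bko_h_less:
  assumes "\<beta> > 0" "0 < f" "f < 1" "0 < s" "s < t"
  shows "bko_h \<beta> f s < bko_h \<beta> f t"
proof -
  have "t powr (- 4 * \<beta>) < s powr (- 4 * \<beta>)" "t powr (- 2 * \<beta> - 2) < s powr (- 2 * \<beta> - 2)"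
    using assms by (auto intro!: powr_less_mono2_neg)
  then have "f * ((2 * \<beta> + 1) * (\<beta> + 1)) * t powr (- 4 * \<beta>) < f * ((2 * \<beta> + 1) * (\<beta> + 1)) * s powr (- 4 * \<beta>)"
    "6 * (1 - f) * t powr (- 2 * \<beta> - 2) < 6 * (1 - f) * s powr (- 2 * \<beta> - 2)"
    using assms by (auto intro!: mult_strict_left_mono mult_pos_pos)
  then show ?thesis
    unfolding bko_h_def by linarith
qed

text \<open>The quadratic \<open>(2 * \<beta> - 1) * (\<beta> - 1)\<close> is nonpositive between
  its roots 1/2 and 1, and the two subtracted terms are strictly positive.\<close>

lemma bko_h_neg:
  assumes "1 / 2 \<le> \<beta>" "\<beta> \<le> 1" "0 < f" "f < 1" "s > 0"
  shows "bko_h \<beta> f s < 0"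
proof -
  have "(1 - f) * ((2 * \<beta> - 1) * (\<beta> - 1)) \<le> 0"
    using assms by (intro mult_nonneg_nonpos) auto
  moreover have "f * ((2 * \<beta> + 1) * (\<beta> + 1)) * s powr (- 4 * \<beta>) > 0"
    "6 * (1 - f) * s powr (- 2 * \<beta> - 2) > 0"
    using assms by (auto intro!: mult_pos_pos)
  ultimately show ?thesis
    unfolding bko_h_def by linarith
qed

lemma bko_s0_pos:
  assumes "(2 * \<beta> - 1) * (\<beta> - 1) > 0"
  shows "bko_s0 \<beta> > 0"
  using assms unfolding bko_s0_def by auto

lemma bko_h_s0_neg:
  assumes "\<beta> > 0" "(2 * \<beta> - 1) * (\<beta> - 1) > 0" "0 < f" "f < 1"
  shows "bko_h \<beta> f (bko_s0 \<beta>) < 0"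
proof -
  define c where "c = (2 * \<beta> - 1) * (\<beta> - 1)"
  \<comment> \<open>The exponent in \<open>bko_s0\<close> is minus the reciprocal of
    \<open>- 2 * \<beta> - 2\<close>, so this power simply inverts the base
    \<open>6 / c\<close>.\<close>
  have "bko_s0 \<beta> powr (- 2 * \<beta> - 2) = (6 / c) powr (1 / (2 * \<beta> + 2) * (- 2 * \<beta> - 2))"
    unfolding bko_s0_def c_def by (rule powr_powr)
  also have "1 / (2 * \<beta> + 2) * (- 2 * \<beta> - 2) = - 1"
    using assms by (simp add: field_simps)
  also have "(6 / c) powr (- 1) = c / 6"
    using assms by (simp add: powr_minus c_def)
  finally have s0_powr: "bko_s0 \<beta> powr (- 2 * \<beta> - 2) = c / 6" .
  have "bko_h \<beta> f (bko_s0 \<beta>) = - (f * ((2 * \<beta> + 1) * (\<beta> + 1)) * bko_s0 \<beta> powr (- 4 * \<beta>))"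
    unfolding bko_h_def c_def[symmetric] s0_powr by simp
  moreover have "f * ((2 * \<beta> + 1) * (\<beta> + 1)) * bko_s0 \<beta> powr (- 4 * \<beta>) > 0"
    using assms bko_s0_pos[of \<beta>] by (auto intro!: mult_pos_pos)
  ultimately show ?thesis
    by linarith
qed

text \<open>The intermediate value theorem applies between \<open>bko_s0 \<beta>\<close>, where the
  value is negative, and a far point where the positive limit at infinity forces a positive
  value.\<close>

lemma bko_h_zero:
  assumes "\<beta> > 0" "(2 * \<beta> - 1) * (\<beta> - 1) > 0" "0 < f" "f < 1"
  obtains t where "t > bko_s0 \<beta>" "bko_h \<beta> f t = 0"
proof -
  let ?c = "(1 - f) * ((2 * \<beta> - 1) * (\<beta> - 1))" and ?s = "bko_s0 \<beta>"
  \<comment> \<open>The vanishing terms stay as products with 0, the shape in which the limit rules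
    produce them.\<close>
  have "(bko_h \<beta> f \<longlongrightarrow> ?c - f * ((2 * \<beta> + 1) * (\<beta> + 1)) * 0 - 6 * (1 - f) * 0) at_top"
    unfolding bko_h_def using assms
    by (intro tendsto_intros tendsto_neg_powr filterlim_ident) auto
  then have "eventually (\<lambda>t. bko_h \<beta> f t > 0) at_top"
    using assms(2,4) by (intro order_tendstoD(1)) (assumption, simp)
  then obtain u where u: "u \<ge> ?s" "bko_h \<beta> f u > 0"
    using eventually_happens'[OF _ eventually_conj[OF eventually_ge_at_top[of ?s]]] by auto
  have "continuous_on {?s..u} (bko_h \<beta> f)"
    unfolding bko_h_def using bko_s0_pos[OF assms(2)] by (intro continuous_intros) auto
  then obtain t where t: "?s \<le> t" "bko_h \<beta> f t = 0"
    using IVT'[of "bko_h \<beta> f" ?s 0 u] bko_h_s0_neg[OF assms] u by force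
  \<comment> \<open>The intermediate value theorem gives only a weak inequality; the strict sign at
    the left end excludes equality.\<close>
  moreover have "t \<noteq> ?s"
    using t bko_h_s0_neg[OF assms] by auto
  ultimately show ?thesis
    using that[of t] by simp
qed

text \<open>The sign change in (iii) is read in its strong form: one zero beyond
  \<open>bko_s0 \<beta>\<close>, with opposite strict signs on its two sides.\<close>

theorem mainTheorem9:
  fixes lam \<mu> \<rho>\<^sub>0 \<beta> f :: real and P'' :: "real \<Rightarrow> real"
  assumes "lam > 0" and "\<mu> > 0" and "\<rho>\<^sub>0 > 0"
    and "\<beta> = lam / (2 * \<mu>)"
    and "f \<in> {0<..<1}"
    and "P'' = deriv (deriv (bko_P \<mu> \<rho>\<^sub>0 \<beta> f))"
  shows "(\<beta> \<in> {1/2..1} \<longrightarrow> (\<forall>s>0. P'' s < 0)) \<and>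
         (\<beta> \<in> {0<..<1/2} \<union> {1<..} \<longrightarrow>
            (\<forall>s. 0 < s \<and> s \<le> bko_s0 \<beta> \<longrightarrow> P'' s < 0)) \<and>
         (\<beta> \<in> {0<..<1/2} \<union> {1<..} \<longrightarrow>
            (\<exists>s\<^sub>2 > bko_s0 \<beta>.
               (\<forall>s. 0 < s \<and> s < s\<^sub>2 \<longrightarrow> P'' s < 0) \<and>
               P'' s\<^sub>2 = 0 \<and>
               (\<forall>s > s\<^sub>2. P'' s > 0)))"
proof -
  have \<beta>: "\<beta> > 0" and f: "0 < f" "f < 1"
    using assms by auto
  define K where "K s = 2 * \<mu> / \<rho>\<^sub>0 * s powr (2 * \<beta> - 3)" for s
  have "P'' s = K s * bko_h \<beta> f s" and "K s > 0" if "s > 0" for s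
    using deriv_deriv_bko_P[OF that] assms that by (simp_all add: K_def)
  then have sign: "P'' s < 0 \<longleftrightarrow> bko_h \<beta> f s < 0" "P'' s > 0 \<longleftrightarrow> bko_h \<beta> f s > 0"
    "P'' s = 0 \<longleftrightarrow> bko_h \<beta> f s = 0" if "s > 0" for s
    using that by (force simp: mult_less_0_iff zero_less_mult_iff)+
  \<comment> \<open>Both factors are negative below 1/2 and both are positive above 1.\<close>
  have c: "(2 * \<beta> - 1) * (\<beta> - 1) > 0" if "\<beta> \<in> {0<..<1/2} \<union> {1<..}"
    using that by (auto intro: mult_pos_pos mult_neg_neg)
  have "\<forall>s>0. P'' s < 0" if "\<beta> \<in> {1/2..1}"
    using that bko_h_neg f sign(1) by auto
  moreover have "\<forall>s. 0 < s \<and> s \<le> bko_s0 \<beta> \<longrightarrow> P'' s < 0" if "\<beta> \<in> {0<..<1/2} \<union> {1<..}"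
  proof (intro allI impI)
    fix s assume s: "0 < s \<and> s \<le> bko_s0 \<beta>"
    then have "bko_h \<beta> f s \<le> bko_h \<beta> f (bko_s0 \<beta>)"
      using bko_h_less[OF \<beta> f, of s "bko_s0 \<beta>"] by (auto simp: order_le_less)
    then show "P'' s < 0"
      using sign(1)[of s] s bko_h_s0_neg[OF \<beta> c[OF that] f] by simp
  qed
  moreover have "\<exists>s\<^sub>2 > bko_s0 \<beta>. (\<forall>s. 0 < s \<and> s < s\<^sub>2 \<longrightarrow> P'' s < 0) \<and> P'' s\<^sub>2 = 0 \<and> (\<forall>s > s\<^sub>2. P'' s > 0)"
    if "\<beta> \<in> {0<..<1/2} \<union> {1<..}"
  proof -
    note cpos = c[OF that]
    obtain t where t: "t > bko_s0 \<beta>" "bko_h \<beta> f t = 0"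
      using bko_h_zero[OF \<beta> cpos f] .
    have "t > 0"
      using t(1) bko_s0_pos[OF cpos] by linarith
    \<comment> \<open>Strict monotonicity makes the zero \<open>t\<close> of \<open>bko_h\<close>
      separate negative values from positive ones, so \<open>t\<close> serves as the
      witness.\<close>
    have "P'' s < 0" if "0 < s" "s < t" for s
      using sign(1)[of s] bko_h_less[OF \<beta> f that] that t(2) by simp
    moreover have "P'' s > 0" if "t < s" for s
      using sign(2)[of s] bko_h_less[OF \<beta> f \<open>t > 0\<close> that] that t(2) \<open>t > 0\<close> by simp
    ultimately show ?thesis
      using t sign(3)[OF \<open>t > 0\<close>] by blast
  qed
  ultimately show ?thesis
    by blast
qed

end
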